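(* Let $f\in H^2(\mathcal U)$ be written as $$f(x+iy)=\frac1{\sqrt{2\pi}}\int_0^\infty g(t)e^{-yt}e^{ixt}\,dt,\qquad x+iy\in\mathcal U,$$ with $g\in L^2(\mathbb R)$, $\operatorname{supp}g\subseteq[0,+\infty)$. For $0<\varepsilon\leqslant1$ let $h=h_\varepsilon:\varepsilon\mathbb Z^2_+\to\mathbb C$ be $$h(\varepsilon m+i\varepsilon n)=\frac1{\sqrt{2\pi}}\int_0^{\pi/\varepsilon}g(t)\,e^{im\varepsilon t}\Big(\frac{\cos(\varepsilon t)}{1+\sin(\varepsilon t)}\Big)^n dt,\qquad m\in\mathbb Z,\ n\geqslant0.$$ Then for every compact set $K\subseteq\mathcal U$, $$\sup_{K\cap\varepsilon\mathbb Z^2_+}|f-h|\leqslant C_K\,\|g\|_{L^2((\frac{\pi}{2\varepsilon},\frac{\pi}{\varepsilon}))}+O(\varepsilon^{1/4}),$$ where $C_K$ is a constant depending only on $K$, not on $\varepsilon$ or $f$ (and the implicit constant in $O(\varepsilon^{1/4})$ may depend on $K$ and $f$, but not on $\varepsilon$).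
   Context: $\mathcal U=\{x+iy\in\mathbb C: y>0\}$ is the open upper half-plane and $H^2(\mathcal U)$ is the classical Hardy space on it; by the classical Paley--Wiener theorem every $f\in H^2(\mathcal U)$ has the stated integral representation. $\mathbb Z^2_+=\{m+in: m,n\in\mathbb Z,\ n\geqslant 0\}\subseteq\mathbb C$ and $\varepsilon\mathbb Z^2_+=\{\varepsilon z: z\in\mathbb Z^2_+\}$. The supremum over an empty set is taken to be $0$. *)

theory Defs
  imports "HOL-Analysis.Analysis"
begin

definition upper_half_plane :: "complex set" where
  "upper_half_plane = {z. Im z > 0}"

definition hardy_H2 :: "(complex \<Rightarrow> complex) set" where
  "hardy_H2 = {f. f holomorphic_on upper_half_plane \<and>
     (SUP y\<in>{0<..}. \<integral>\<^sup>+ x. ennreal ((cmod (f (Complex x y)))\<^sup>2) \<partial>lborel) < \<infinity>}"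

text \<open>Elements of \<open>L\<^sup>2(\<real>)\<close> are represented by Lebesgue measurable functions, not by equivalence
  classes; accordingly the support below is the essential one, which does not depend on the
  representative.\<close>

definition L2_real :: "(real \<Rightarrow> complex) set" where
  "L2_real = {g \<in> borel_measurable lebesgue. integrable lebesgue (\<lambda>t. (cmod (g t))\<^sup>2)}"

definition L2_norm_on :: "real set \<Rightarrow> (real \<Rightarrow> complex) \<Rightarrow> real" where
  "L2_norm_on A g = sqrt (LINT t:A|lebesgue. (cmod (g t))\<^sup>2)"

definition ess_supp :: "(real \<Rightarrow> complex) \<Rightarrow> real set" where
  "ess_supp g = - \<Union>{V. open V \<and> (AE t in lebesgue. t \<in> V \<longrightarrow> g t = 0)}"

definition half_lattice :: "complex set" where
  "half_lattice = {of_int m + \<i> * of_nat n | (m::int) (n::nat). True}"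

definition scaled_half_lattice :: "real \<Rightarrow> complex set" where
  "scaled_half_lattice \<epsilon> = (\<lambda>z. of_real \<epsilon> * z) ` half_lattice"

text \<open>\<open>Sup {}\<close> is unspecified in type \<^typ>\<open>real\<close>, hence the case distinction. The function is only
  meaningful if \<open>F\<close> is bounded on \<open>S\<close>, in particular for finite \<open>S\<close> such as the intersection of a
  compact set with the scaled lattice.\<close>

definition sup_abs_on :: "complex set \<Rightarrow> (complex \<Rightarrow> complex) \<Rightarrow> real" where
  "sup_abs_on S F = (if S = {} then 0 else (SUP z\<in>S. cmod (F z)))"

end

theory Submission
  imports Defs
begin

text \<open>
  Write \<open>r s = cos s / (1 + sin s)\<close>. On \<open>[0, \<pi>/2]\<close> we have \<open>1 - s \<le> r s \<le> exp (- s)\<close>, and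
  \<open>r (\<pi> - s) = - r s\<close>. At a lattice point of height \<open>y = \<epsilon> n\<close> the integrands of \<open>f\<close> and \<open>h\<close>
  differ only in the kernels \<open>exp (- y t)\<close> and \<open>r (\<epsilon> t) ^ n\<close>. For \<open>t \<le> \<pi>/(2\<epsilon>)\<close> these are
  \<open>O(\<epsilon> t\<^sup>2 exp (- y t))\<close> apart. Beyond that point \<open>exp (- y t) \<le> \<epsilon> t exp (- y t)\<close>, while
  \<open>\<bar>r (\<epsilon> t) ^ n\<bar> \<le> exp (- y (\<pi>/\<epsilon> - t))\<close>, whose \<open>L\<^sup>2\<close> norm is at most \<open>1 / sqrt (2 y)\<close>.
  Cauchy-Schwarz gives the constant \<open>C\<^sub>K\<close>, and the remaining error is even \<open>O(\<epsilon>)\<close>.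
\<close>

section \<open>Cauchy-Schwarz and integrals of exponentials\<close>

text \<open>Transfers the inequality for nonnegative integrals to Bochner integrals; the product is
  integrable because \<open>u\<^sup>2 + v\<^sup>2\<close> dominates it.\<close>

lemma Cauchy_Schwarz_integral:
  fixes u v :: "'a \<Rightarrow> real"
  assumes [measurable]: "u \<in> borel_measurable M" "v \<in> borel_measurable M"
    and u2: "integrable M (\<lambda>x. (u x)\<^sup>2)" and v2: "integrable M (\<lambda>x. (v x)\<^sup>2)"
  shows "integrable M (\<lambda>x. u x * v x)"
    and "(\<integral>x. u x * v x \<partial>M) \<le> sqrt (\<integral>x. (u x)\<^sup>2 \<partial>M) * sqrt (\<integral>x. (v x)\<^sup>2 \<partial>M)"
proof -
  show int: "integrable M (\<lambda>x. u x * v x)"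
  proof (rule Bochner_Integration.integrable_bound)
    show "integrable M (\<lambda>x. (u x)\<^sup>2 + (v x)\<^sup>2)"
      using u2 v2 by simp
    have "\<bar>u x * v x\<bar> \<le> (u x)\<^sup>2 + (v x)\<^sup>2" for x
      using sum_squares_bound[of "\<bar>u x\<bar>" "\<bar>v x\<bar>"] mult_nonneg_nonneg[of "\<bar>u x\<bar>" "\<bar>v x\<bar>"]
      unfolding abs_mult power2_abs by linarith
    then show "AE x in M. norm (u x * v x) \<le> norm ((u x)\<^sup>2 + (v x)\<^sup>2)"
      by simp
  qed (use assms in measurable)
  let ?U = "\<integral>x. (u x)\<^sup>2 \<partial>M" and ?V = "\<integral>x. (v x)\<^sup>2 \<partial>M" and ?I = "\<integral>x. \<bar>u x * v x\<bar> \<partial>M"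
  have "ennreal (?I\<^sup>2) = (\<integral>\<^sup>+x. ennreal \<bar>u x\<bar> * ennreal \<bar>v x\<bar> \<partial>M)\<^sup>2"
    using integrable_norm[OF int]
    by (simp add: nn_integral_eq_integral abs_mult ennreal_power flip: ennreal_mult)
  also have "\<dots> \<le> (\<integral>\<^sup>+x. (ennreal \<bar>u x\<bar>)\<^sup>2 \<partial>M) * (\<integral>\<^sup>+x. (ennreal \<bar>v x\<bar>)\<^sup>2 \<partial>M)"
    by (rule Cauchy_Schwarz_nn_integral) measurable
  also have "\<dots> = ennreal (?U * ?V)"
    using u2 v2 by (simp add: nn_integral_eq_integral ennreal_power ennreal_mult)
  finally have "?I\<^sup>2 \<le> ?U * ?V"
    by (subst (asm) ennreal_le_iff) auto
  then have "?I \<le> sqrt (?U * ?V)"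
    by (rule real_le_rsqrt)
  moreover have "(\<integral>x. u x * v x \<partial>M) \<le> ?I"
    using int by (intro integral_mono) auto
  ultimately show "(\<integral>x. u x * v x \<partial>M) \<le> sqrt ?U * sqrt ?V"
    by (simp add: real_sqrt_mult)
qed

lemma integrable_exp_Ici:
  fixes a :: real
  assumes "a > 0"
  shows "integrable lebesgue (\<lambda>t. indicator {0..} t * exp (- a * t))"
  using nonnegative_absolutely_integrable_1[OF integrable_on_exp_minus_to_infinity[OF assms, of 0]]
  by (simp add: set_integrable_def)

text \<open>The square is an exponential with an explicit primitive, and the contribution of the
  left endpoint is dropped. The bound does not see the length of the interval, which keeps the final
  constant independent of \<epsilon>.\<close>

lemma exp_reflected_square_integral:
  fixes a b c k :: real
  assumes "k > 0" "a \<le> b"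
  defines "w \<equiv> \<lambda>t. (indicator {a<..<b} t * exp (- k * (b - t)))\<^sup>2"
  shows "integrable lebesgue w" and "(\<integral>t. w t \<partial>lebesgue) \<le> 1 / (2 * k)"
proof -
  have "((\<lambda>t. exp (- (2 * k) * (b - t))) has_integral
      exp (- (2 * k) * (b - b)) / (2 * k) - exp (- (2 * k) * (b - a)) / (2 * k)) {a..b}"
    using assms by (intro fundamental_theorem_of_calculus)
      (auto intro!: derivative_eq_intros simp flip: has_real_derivative_iff_has_vector_derivative)
  then have I: "((\<lambda>t. exp (- (2 * k) * (b - t))) has_integral
      (1 - exp (- (2 * k) * (b - a))) / (2 * k)) {a<..<b}"
    by (simp add: diff_divide_distrib has_integral_Icc_iff_Ioo)
  have w: "w t = indicator {a<..<b} t *\<^sub>R exp (- (2 * k) * (b - t))" for t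
    by (auto simp: w_def indicator_def power2_eq_square simp flip: exp_add)
  have S: "set_integrable lebesgue {a<..<b} (\<lambda>t. exp (- (2 * k) * (b - t)))"
    using I by (intro nonnegative_absolutely_integrable_1) auto
  then show "integrable lebesgue w"
    unfolding w by (simp add: set_integrable_def)
  have "(\<integral>t. w t \<partial>lebesgue) = (1 - exp (- (2 * k) * (b - a))) / (2 * k)"
    using set_lebesgue_integral_eq_integral(2)[OF S] I
    by (simp add: w set_lebesgue_integral_def integral_unique)
  also have "\<dots> \<le> 1 / (2 * k)"
    using \<open>k > 0\<close> by (intro divide_right_mono) auto
  finally show "(\<integral>t. w t \<partial>lebesgue) \<le> 1 / (2 * k)" .
qed

section \<open>The multiplier of \<open>h\<close> and its comparison with the exponential\<close>

text \<open>This is \<open>tan (pi / 4 - s / 2)\<close>, or \<open>(1 - w) / (1 + w)\<close> with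
  \<open>w = tan (s / 2)\<close> where that tangent is defined, hence the name.\<close>

definition cayley :: "real \<Rightarrow> real" where
  "cayley s = cos s / (1 + sin s)"

lemma cayley_nonneg:
  assumes "0 \<le> s" "s \<le> pi / 2"
  shows "0 \<le> cayley s"
  unfolding cayley_def using assms sin_ge_zero[of s] cos_ge_zero[of s] by auto

lemma has_real_derivative_cayley:
  assumes "0 \<le> s" "s \<le> pi / 2"
  shows "(cayley has_real_derivative - 1 / (1 + sin s)) (at s)"
proof -
  have pos: "1 + sin s > 0"
    using assms sin_ge_zero[of s] by auto
  have "((\<lambda>s. cos s / (1 + sin s)) has_real_derivative
      (- sin s * (1 + sin s) - cos s * cos s) / ((1 + sin s) * (1 + sin s))) (at s)"
    using pos by (auto intro!: derivative_eq_intros)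
  also have "- sin s * (1 + sin s) - cos s * cos s = - (1 + sin s)"
    using sin_cos_squared_add[of s] by (simp add: algebra_simps power2_eq_square)
  also have "- (1 + sin s) / ((1 + sin s) * (1 + sin s)) = - 1 / (1 + sin s)"
    using pos by (simp add: divide_simps)
  finally show ?thesis
    by (simp add: cayley_def[abs_def])
qed

text \<open>The product \<open>cayley s * exp s\<close> starts at 1 and decreases, since its
  derivative has the sign of \<open>cos s - 1\<close>.\<close>

lemma cayley_le_exp:
  assumes "0 \<le> s" "s \<le> pi / 2"
  shows "cayley s \<le> exp (- s)"
proof -
  have "cayley s * exp s \<le> cayley 0 * exp 0"
  proof (rule DERIV_nonpos_imp_nonincreasing[OF assms(1)])
    fix x assume x: "0 \<le> x" "x \<le> s"
    then have x': "0 \<le> x" "x \<le> pi / 2"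
      using assms by auto
    have pos: "1 + sin x > 0"
      using x' sin_ge_zero[of x] by auto
    have "((\<lambda>s. cayley s * exp s) has_real_derivative
        (- 1 / (1 + sin x)) * exp x + exp x * cayley x) (at x)"
      using has_real_derivative_cayley[OF x'] by (auto intro!: derivative_eq_intros)
    also have "(- 1 / (1 + sin x)) * exp x + exp x * cayley x
        = exp x * ((cos x - 1) / (1 + sin x))"
      by (simp add: cayley_def diff_divide_distrib algebra_simps)
    finally show "\<exists>y. ((\<lambda>s. cayley s * exp s) has_real_derivative y) (at x) \<and> y \<le> 0"
      using pos by (auto intro!: exI mult_nonneg_nonpos divide_nonpos_pos)
  qed
  then have "cayley s * exp s \<le> 1"
    by (simp add: cayley_def)
  then show ?thesis
    by (simp add: exp_minus field_simps)
qed

lemma cayley_ge: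
  assumes "0 \<le> s" "s \<le> pi / 2"
  shows "1 - s \<le> cayley s"
proof -
  have "cayley 0 + 0 \<le> cayley s + s"
  proof (rule DERIV_nonneg_imp_nondecreasing[OF assms(1)])
    fix x assume x: "0 \<le> x" "x \<le> s"
    then have x': "0 \<le> x" "x \<le> pi / 2"
      using assms by auto
    have "((\<lambda>s. cayley s + s) has_real_derivative (- 1 / (1 + sin x)) + 1) (at x)"
      using has_real_derivative_cayley[OF x'] by (auto intro!: derivative_eq_intros)
    moreover have "(- 1 / (1 + sin x)) + 1 \<ge> 0"
      using x' sin_ge_zero[of x] by (auto simp: divide_simps)
    ultimately show "\<exists>y. ((\<lambda>s. cayley s + s) has_real_derivative y) (at x) \<and> 0 \<le> y"
      by blast
  qed
  then show ?thesis
    by (simp add: cayley_def)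
qed

text \<open>Together with \<open>cayley_ge\<close> this shows that \<open>exp (- s)\<close> exceeds
  \<open>cayley s\<close> by at most \<open>s\<^sup>2 / 2\<close>.\<close>

lemma exp_minus_le_quadratic:
  fixes s :: real
  assumes "0 \<le> s"
  shows "exp (- s) \<le> 1 - s + s\<^sup>2 / 2"
proof -
  have "exp (- 0) - (1 - 0 + 0\<^sup>2 / 2) \<ge> exp (- s) - (1 - s + s\<^sup>2 / 2)"
  proof (rule DERIV_nonpos_imp_nonincreasing[OF assms])
    fix x :: real assume "0 \<le> x"
    have "((\<lambda>s. exp (- s) - (1 - s + s\<^sup>2 / 2)) has_real_derivative (- exp (- x) - (- 1 + x))) (at x)"
      by (auto intro!: derivative_eq_intros)
    moreover have "- exp (- x) - (- 1 + x) \<le> 0"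
      using exp_ge_add_one_self[of "- x"] by simp
    ultimately show "\<exists>y. ((\<lambda>s. exp (- s) - (1 - s + s\<^sup>2 / 2)) has_real_derivative y) (at x) \<and> y \<le> 0"
      by blast
  qed
  then show ?thesis
    by simp
qed

text \<open>A mean value estimate for the \<open>n\<close>-th power. For \<open>n = 0\<close> the
  truncated exponent \<open>n - 1\<close> is harmless because of the factor
  \<open>n\<close>.\<close>

lemma power_diff_le:
  fixes a b :: real
  assumes "0 \<le> b" "b \<le> a"
  shows "a ^ n - b ^ n \<le> n * (a - b) * a ^ (n - 1)"
proof (induction n)
  case (Suc n)
  have "a ^ Suc n - b ^ Suc n = a * (a ^ n - b ^ n) + (a - b) * b ^ n"
    by (simp add: algebra_simps)
  also have "\<dots> \<le> a * (n * (a - b) * a ^ (n - 1)) + (a - b) * a ^ n"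
    using assms Suc by (intro add_mono mult_left_mono power_mono) auto
  also have "\<dots> = Suc n * (a - b) * a ^ (Suc n - 1)"
    \<comment> \<open>The product \<open>a * a ^ (n - 1)\<close> is \<open>a ^ n\<close> only for
      \<open>n > 0\<close>; for \<open>n = 0\<close> its coefficient vanishes.\<close>
    by (cases n) (auto simp: algebra_simps)
  finally show ?case .
qed simp

lemma cayley_power_near:
  assumes "0 \<le> s" "s \<le> pi / 2"
  shows "\<bar>exp (- s * n) - cayley s ^ n\<bar> \<le> exp (pi / 2) / 2 * n * s\<^sup>2 * exp (- s * n)"
proof -
  have r: "0 \<le> cayley s" "cayley s \<le> exp (- s)"
    using cayley_nonneg cayley_le_exp assms by auto
  have "cayley s ^ n \<le> exp (- s) ^ n"
    using r by (intro power_mono)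
  moreover have "exp (- s) ^ n - cayley s ^ n \<le> n * (exp (- s) - cayley s) * exp (- s) ^ (n - 1)"
    using r by (rule power_diff_le)
  moreover have "n * (exp (- s) - cayley s) * exp (- s) ^ (n - 1)
      \<le> n * (s\<^sup>2 / 2) * exp (- s) ^ (n - 1)"
    using cayley_ge[OF assms] exp_minus_le_quadratic[OF assms(1)]
    by (intro mult_right_mono mult_left_mono) auto
  \<comment> \<open>Restoring the missing power costs a factor \<open>exp s\<close>, at most
    \<open>exp (pi / 2)\<close>; for \<open>n = 0\<close> both powers are 1.\<close>
  moreover have "exp (- s) ^ (n - 1) \<le> exp (pi / 2) * exp (- s * n)"
    using assms by (cases n) (auto simp: algebra_simps simp flip: exp_of_nat_mult exp_add)
  then have "n * (s\<^sup>2 / 2) * exp (- s) ^ (n - 1) \<le> n * (s\<^sup>2 / 2) * (exp (pi / 2) * exp (- s * n))"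
    by (intro mult_left_mono) auto
  ultimately show ?thesis
    by (simp add: mult_ac flip: exp_of_nat_mult)
qed

text \<open>The reflection of \<open>s\<close> to \<open>pi - s\<close> fixes the sine and negates
  the cosine, so the estimate on the first half of the range applies. Near \<open>s = pi\<close> the
  multiplier has modulus close to 1, which is why the norm of \<open>g\<close> on the far interval
  enters the result.\<close>

lemma cayley_power_far:
  assumes "pi / 2 \<le> s" "s \<le> pi"
  shows "\<bar>cayley s ^ n\<bar> \<le> exp (- (pi - s) * n)"
proof -
  have "cayley s = - cayley (pi - s)"
    by (simp add: cayley_def)
  then have "\<bar>cayley s\<bar> \<le> exp (- (pi - s))"
    using cayley_nonneg[of "pi - s"] cayley_le_exp[of "pi - s"] assms by auto
  then have "\<bar>cayley s\<bar> ^ n \<le> exp (- (pi - s)) ^ n"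
    by (intro power_mono) auto
  then show ?thesis
    by (simp add: power_abs mult_ac flip: exp_of_nat_mult)
qed

section \<open>Pointwise comparison of the two kernels\<close>

text \<open>Half of the exponential decay absorbs the polynomial: with \<open>u = a * t / 2\<close>,
  both \<open>u\<close> and \<open>u\<^sup>2 / 2\<close> are at most \<open>exp u\<close>.\<close>

lemma polynomial_exp_bounds:
  fixes a t :: real
  assumes "a > 0" "t \<ge> 0"
  shows "t * exp (- a * t) \<le> 2 / a * exp (- (a / 2) * t)"
    and "t\<^sup>2 * exp (- a * t) \<le> 8 / a\<^sup>2 * exp (- (a / 2) * t)"
proof -
  define u where "u = a * t / 2"
  have E: "exp (- a * t) = exp (- (a / 2) * t) * exp (- u)"
    by (simp add: u_def flip: exp_add)
  have "u \<ge> 0"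
    using assms by (simp add: u_def)
  then have "1 + u + u\<^sup>2 / 2 \<le> exp u"
    by (rule exp_lower_Taylor_quadratic)
  then have "u \<le> exp u" "u\<^sup>2 / 2 \<le> exp u"
    using \<open>u \<ge> 0\<close> zero_le_power2[of u] by linarith+
  then have 1: "u * exp (- u) \<le> 1" and 2: "u\<^sup>2 / 2 * exp (- u) \<le> 1"
    by (auto simp: exp_minus field_simps)
  have "t * exp (- a * t) = 2 / a * exp (- (a / 2) * t) * (u * exp (- u))"
    unfolding E using assms by (simp add: u_def)
  also have "\<dots> \<le> 2 / a * exp (- (a / 2) * t) * 1"
    using assms by (intro mult_left_mono 1) auto
  finally show "t * exp (- a * t) \<le> 2 / a * exp (- (a / 2) * t)"
    by simp
  have "t\<^sup>2 * exp (- a * t) = 8 / a\<^sup>2 * exp (- (a / 2) * t) * (u\<^sup>2 / 2 * exp (- u))"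
    unfolding E using assms by (simp add: u_def field_simps power2_eq_square)
  also have "\<dots> \<le> 8 / a\<^sup>2 * exp (- (a / 2) * t) * 1"
    using assms by (intro mult_left_mono 2) auto
  finally show "t\<^sup>2 * exp (- a * t) \<le> 8 / a\<^sup>2 * exp (- (a / 2) * t)"
    by simp
qed

text \<open>The first summand is \<open>exp (pi / 2) / 2 * b * (8 / a\<^sup>2)\<close>, from the
  range up to \<open>pi / (2 * \<epsilon>)\<close>; the second comes from the tail of
  \<open>exp (- y t)\<close> beyond it.\<close>

definition kernel_const :: "real \<Rightarrow> real \<Rightarrow> real" where
  "kernel_const a b = 4 * exp (pi / 2) * b / a\<^sup>2 + 2 / a"

text \<open>The point \<open>pi / \<epsilon>\<close> is excluded because there the kernel of
  \<open>h\<close> has modulus 1 while the open interval on the right misses it.\<close>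

lemma kernel_diff_le:
  fixes \<epsilon> a b t :: real and n :: nat
  assumes \<epsilon>: "0 < \<epsilon>" and a: "0 < a" "a \<le> \<epsilon> * n" and b: "\<epsilon> * n \<le> b"
    and t: "0 \<le> t" "t \<noteq> pi / \<epsilon>"
  shows "\<bar>exp (- (\<epsilon> * n) * t) - indicator {0..pi / \<epsilon>} t * cayley (\<epsilon> * t) ^ n\<bar>
    \<le> kernel_const a b * \<epsilon> * exp (- (a / 2) * t)
      + indicator {pi / (2 * \<epsilon>)<..<pi / \<epsilon>} t * exp (- (\<epsilon> * n) * (pi / \<epsilon> - t))"
proof (cases "t \<le> pi / (2 * \<epsilon>)")
  case True
  have s: "0 \<le> \<epsilon> * t" "\<epsilon> * t \<le> pi / 2"
    using True \<epsilon> t by (auto simp: field_simps)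
  have "\<epsilon> * t \<le> pi"
    using s(2) pi_gt_zero by linarith
  then have "t \<le> pi / \<epsilon>"
    using \<epsilon> by (simp add: field_simps)
  then have ind: "indicator {0..pi / \<epsilon>} t = (1::real)"
    using t by simp
  have "\<bar>exp (- (\<epsilon> * n) * t) - cayley (\<epsilon> * t) ^ n\<bar>
      \<le> exp (pi / 2) / 2 * n * (\<epsilon> * t)\<^sup>2 * exp (- (\<epsilon> * n) * t)"
    using cayley_power_near[OF s, of n] by (simp add: mult_ac)
  also have "\<dots> = exp (pi / 2) / 2 * \<epsilon> * (\<epsilon> * n) * (t\<^sup>2 * exp (- (\<epsilon> * n) * t))"
    by (simp add: power2_eq_square)
  also have "\<dots> \<le> exp (pi / 2) / 2 * \<epsilon> * b * (t\<^sup>2 * exp (- a * t))"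
    using a b \<epsilon> t by (intro mult_mono mult_left_mono) (auto intro: mult_right_mono)
  also have "\<dots> \<le> exp (pi / 2) / 2 * \<epsilon> * b * (8 / a\<^sup>2 * exp (- (a / 2) * t))"
    using a b \<epsilon> t by (intro mult_left_mono polynomial_exp_bounds) auto
  also have "\<dots> \<le> kernel_const a b * \<epsilon> * exp (- (a / 2) * t)"
    using a \<epsilon> by (simp add: kernel_const_def algebra_simps)
  finally show ?thesis
    by (simp add: ind add_increasing2)
next
  case False
  have "exp (- (\<epsilon> * n) * t) \<le> exp (- a * t)"
    using a t by (auto intro: mult_right_mono)
  also have "\<dots> \<le> \<epsilon> * (t * exp (- a * t))"
  proof -
    \<comment> \<open>Here \<open>\<epsilon> * t\<close> exceeds 1, so inserting it as a factor
      gains the power of \<epsilon> needed for the error term.\<close>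
    have "pi / 2 < \<epsilon> * t"
      using False \<epsilon> by (simp add: field_simps)
    then have "1 \<le> \<epsilon> * t"
      using pi_gt3 by linarith
    then have "1 * exp (- a * t) \<le> (\<epsilon> * t) * exp (- a * t)"
      by (intro mult_right_mono) auto
    then show ?thesis
      by (simp add: mult_ac)
  qed
  also have "\<dots> \<le> \<epsilon> * (2 / a * exp (- (a / 2) * t))"
    using a t \<epsilon> by (intro mult_left_mono polynomial_exp_bounds) auto
  also have "\<dots> \<le> kernel_const a b * \<epsilon> * exp (- (a / 2) * t)"
    using a b \<epsilon> by (simp add: kernel_const_def algebra_simps)
  finally have 1: "exp (- (\<epsilon> * n) * t) \<le> kernel_const a b * \<epsilon> * exp (- (a / 2) * t)" .
  \<comment> \<open>Past \<open>pi / \<epsilon>\<close> both indicators vanish, so only the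
    reflected range needs work.\<close>
  have 2: "\<bar>indicator {0..pi / \<epsilon>} t * cayley (\<epsilon> * t) ^ n\<bar>
      \<le> indicator {pi / (2 * \<epsilon>)<..<pi / \<epsilon>} t * exp (- (\<epsilon> * n) * (pi / \<epsilon> - t))"
  proof (cases "t < pi / \<epsilon>")
    case True
    have "\<bar>cayley (\<epsilon> * t) ^ n\<bar> \<le> exp (- (pi - \<epsilon> * t) * n)"
      using True False \<epsilon> by (intro cayley_power_far) (auto simp: field_simps)
    also have "- (pi - \<epsilon> * t) * n = - (\<epsilon> * n) * (pi / \<epsilon> - t)"
      using \<epsilon> by (simp add: field_simps)
    finally show ?thesis
      using True False t by simp
  qed (use t in auto)
  from 1 2 show ?thesis
    using exp_gt_zero[of "- (\<epsilon> * n) * t"] by linarith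
qed

section \<open>Integral estimates\<close>

text \<open>Supplies the integrable majorant for the integrand of \<open>f\<close>; its integral
  becomes part of the implicit constant.\<close>

lemma integrable_norm_mult_exp:
  fixes g :: "real \<Rightarrow> complex" and a :: real
  assumes g: "g \<in> L2_real" and "a > 0"
  shows "integrable lebesgue (\<lambda>t. cmod (g t) * (indicator {0..} t * exp (- a * t)))"
proof (rule Cauchy_Schwarz_integral(1))
  show "integrable lebesgue (\<lambda>t. (cmod (g t))\<^sup>2)" "(\<lambda>t. cmod (g t)) \<in> borel_measurable lebesgue"
    using g by (auto simp: L2_real_def)
  show "(\<lambda>t. indicator {0..} t * exp (- a * t)) \<in> borel_measurable lebesgue"
    by (intro measurable_completion) measurable
  have "(indicator {0..} t * exp (- a * t))\<^sup>2 = indicator {0..} t * exp (- (2 * a) * t)" for t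
    by (auto simp: indicator_def power2_eq_square simp flip: exp_add)
  then show "integrable lebesgue (\<lambda>t. (indicator {0..} t * exp (- a * t))\<^sup>2)"
    using integrable_exp_Ici[of "2 * a"] \<open>a > 0\<close> by simp
qed

lemma integral_norm_mult_reflected_exp_le:
  fixes g :: "real \<Rightarrow> complex" and c d k :: real
  assumes g: "g \<in> L2_real" and "k > 0" "c \<le> d"
  defines "w \<equiv> \<lambda>t. cmod (g t) * (indicator {c<..<d} t * exp (- k * (d - t)))"
  shows "integrable lebesgue w"
    and "(\<integral>t. w t \<partial>lebesgue) \<le> L2_norm_on {c<..<d} g / sqrt (2 * k)"
proof -
  define u where "u t = indicator {c<..<d} t * cmod (g t)" for t
  define v where "v t = indicator {c<..<d} t * exp (- k * (d - t))" for t
  have [measurable]: "g \<in> borel_measurable lebesgue" and g2: "integrable lebesgue (\<lambda>t. (cmod (g t))\<^sup>2)"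
    using g by (auto simp: L2_real_def)
  have um: "u \<in> borel_measurable lebesgue"
    unfolding u_def by (intro borel_measurable_times borel_measurable_indicator) (simp, measurable)
  have vm: "v \<in> borel_measurable lebesgue"
    unfolding v_def by (intro measurable_completion) measurable
  have u2: "(u t)\<^sup>2 = indicator {c<..<d} t *\<^sub>R (cmod (g t))\<^sup>2" for t
    by (simp add: u_def indicator_def)
  have u2_int: "integrable lebesgue (\<lambda>t. (u t)\<^sup>2)"
    unfolding u2 by (intro integrable_mult_indicator g2) simp
  have v2: "integrable lebesgue (\<lambda>t. (v t)\<^sup>2)" "(\<integral>t. (v t)\<^sup>2 \<partial>lebesgue) \<le> 1 / (2 * k)"
    using exp_reflected_square_integral[OF assms(2,3)] by (simp_all add: v_def)
  \<comment> \<open>The indicator is idempotent, so each factor can carry a copy; this localises the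
    norm of \<open>g\<close> to the interval.\<close>
  have w: "w = (\<lambda>t. u t * v t)"
    by (auto simp: w_def u_def v_def indicator_def)
  show "integrable lebesgue w"
    unfolding w by (rule Cauchy_Schwarz_integral(1)[OF um vm u2_int v2(1)])
  have "(\<integral>t. w t \<partial>lebesgue) \<le> L2_norm_on {c<..<d} g * sqrt (\<integral>t. (v t)\<^sup>2 \<partial>lebesgue)"
    using Cauchy_Schwarz_integral(2)[OF um vm u2_int v2(1)]
    by (simp add: w u2 L2_norm_on_def set_lebesgue_integral_def)
  also have "\<dots> \<le> L2_norm_on {c<..<d} g * sqrt (1 / (2 * k))"
    using v2(2) by (intro mult_left_mono real_sqrt_le_mono)
      (auto simp: L2_norm_on_def set_lebesgue_integral_def intro!: integral_nonneg_AE)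
  finally show "(\<integral>t. w t \<partial>lebesgue) \<le> L2_norm_on {c<..<d} g / sqrt (2 * k)"
    by (simp add: real_sqrt_divide)
qed

text \<open>Integrates \<open>kernel_diff_le\<close> against \<open>cmod (g t)\<close>; the
  oscillating factor is common to both integrands and has modulus 1.\<close>

lemma integral_diff_le:
  fixes g :: "real \<Rightarrow> complex" and \<epsilon> a b :: real and m :: int and n :: nat
  assumes g: "g \<in> L2_real" and \<epsilon>: "0 < \<epsilon>" and a: "0 < a" "a \<le> \<epsilon> * n" and b: "\<epsilon> * n \<le> b"
  shows "cmod ((LINT t:{0..}|lebesgue.
        g t * of_real (exp (- (\<epsilon> * n) * t)) * exp (\<i> * of_real (\<epsilon> * m * t))) -
      (LINT t:{0..pi / \<epsilon>}|lebesgue.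
        g t * exp (\<i> * of_real (of_int m * \<epsilon> * t)) * of_real (cayley (\<epsilon> * t) ^ n)))
    \<le> kernel_const a b * \<epsilon> *
        (\<integral>t. cmod (g t) * (indicator {0..} t * exp (- (a / 2) * t)) \<partial>lebesgue)
      + L2_norm_on {pi / (2 * \<epsilon>)<..<pi / \<epsilon>} g / sqrt (2 * a)"
proof -
  define k where "k = \<epsilon> * n"
  define I where "I = {pi / (2 * \<epsilon>)<..<pi / \<epsilon>}"
  define F where "F t = indicator {0..} t *\<^sub>R
    (g t * of_real (exp (- k * t)) * exp (\<i> * of_real (\<epsilon> * m * t)))" for t
  define H where "H t = indicator {0..pi / \<epsilon>} t *\<^sub>R
    (g t * exp (\<i> * of_real (of_int m * \<epsilon> * t)) * of_real (cayley (\<epsilon> * t) ^ n))" for t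
  define P where "P t = cmod (g t) * (indicator {0..} t * exp (- (a / 2) * t))" for t
  define Q where "Q t = cmod (g t) * (indicator I t * exp (- k * (pi / \<epsilon> - t)))" for t
  have k: "k > 0" "a \<le> k"
    using a by (auto simp: k_def)
  have len: "pi / (2 * \<epsilon>) \<le> pi / \<epsilon>"
    using \<epsilon> by (simp add: field_simps)
  have gm: "g \<in> borel_measurable lebesgue"
    using g by (auto simp: L2_real_def)
  have "(\<lambda>t. indicator {0..} t *\<^sub>R (of_real (exp (- k * t)) * exp (\<i> * of_real (\<epsilon> * m * t))))
      \<in> borel_measurable (lebesgue :: real measure)"
    by (intro measurable_completion) measurable
  from borel_measurable_times[OF gm this] have Fm: "F \<in> borel_measurable lebesgue"
    by (simp add: F_def[abs_def] mult.assoc)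
  have "(\<lambda>t. indicator {0..pi / \<epsilon>} t *\<^sub>R
        (exp (\<i> * of_real (of_int m * \<epsilon> * t)) * of_real (cayley (\<epsilon> * t) ^ n)))
      \<in> borel_measurable (lebesgue :: real measure)"
    unfolding cayley_def by (intro measurable_completion) measurable
  from borel_measurable_times[OF gm this] have Hm: "H \<in> borel_measurable lebesgue"
    by (simp add: H_def[abs_def] mult.assoc)
  have P: "integrable lebesgue P"
    unfolding P_def using integrable_norm_mult_exp[OF g, of "a / 2"] a by simp
  have Q: "integrable lebesgue Q"
    and Q_le: "(\<integral>t. Q t \<partial>lebesgue) \<le> L2_norm_on I g / sqrt (2 * k)"
    unfolding Q_def I_def by (fact integral_norm_mult_reflected_exp_le[OF g k(1) len])+
  have "cmod (F t) \<le> norm (P t)" for t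
  proof (cases "t \<ge> 0")
    case True
    have "a / 2 * t \<le> k * t"
      using k a True by (intro mult_right_mono) auto
    then have "exp (- k * t) \<le> exp (- (a / 2) * t)"
      by simp
    then show ?thesis
      using True by (auto simp: F_def P_def norm_mult abs_mult intro: mult_left_mono)
  qed (simp add: F_def P_def)
  then have F: "integrable lebesgue F"
    by (intro Bochner_Integration.integrable_bound[OF P Fm]) auto
  define B where "B t = kernel_const a b * \<epsilon> * P t + Q t" for t
  have B: "integrable lebesgue B"
    unfolding B_def using P Q by simp
  have "cmod (F t - H t) \<le> B t" if "t \<noteq> pi / \<epsilon>" for t
  proof (cases "t \<ge> 0")
    case True
    define e where "e = exp (\<i> * of_real (\<epsilon> * m * t))"
    have "F t - H t = g t * e *
        of_real (exp (- k * t) - indicator {0..pi / \<epsilon>} t * cayley (\<epsilon> * t) ^ n)"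
      using True by (simp add: F_def H_def e_def algebra_simps scaleR_conv_of_real)
    moreover have "cmod e = 1"
      by (simp add: e_def)
    ultimately have "cmod (F t - H t) = cmod (g t) *
        \<bar>exp (- k * t) - indicator {0..pi / \<epsilon>} t * cayley (\<epsilon> * t) ^ n\<bar>"
      by (simp only: norm_mult norm_of_real mult_1_right)
    also have "\<dots> \<le> cmod (g t) * (kernel_const a b * \<epsilon> * exp (- (a / 2) * t)
        + indicator I t * exp (- k * (pi / \<epsilon> - t)))"
      unfolding k_def I_def
      by (intro mult_left_mono kernel_diff_le[OF \<epsilon> a b True that]) simp
    also have "\<dots> = B t"
      using True by (simp add: B_def P_def Q_def algebra_simps)
    finally show ?thesis .
  next
    case False
    moreover have "t \<notin> I"
      using False \<epsilon> by (auto simp: I_def not_le intro: less_trans)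
    ultimately show ?thesis
      by (simp add: F_def H_def B_def P_def Q_def)
  qed
  \<comment> \<open>The single point excluded from the pointwise bound is a null set.\<close>
  moreover have "AE t in lebesgue. t \<noteq> pi / \<epsilon>"
    by (rule AE_completion[OF AE_lborel_singleton])
  ultimately have FH_le: "AE t in lebesgue. cmod (F t - H t) \<le> B t"
    by auto
  have FH: "integrable lebesgue (\<lambda>t. F t - H t)"
    using FH_le by (intro Bochner_Integration.integrable_bound[OF B])
      (auto intro: borel_measurable_diff Fm Hm)
  \<comment> \<open>Integrability of \<open>H\<close> is obtained indirectly: \<open>F\<close> has
    the majorant \<open>P\<close>, and \<open>F - H\<close> has the majorant
    \<open>B\<close>.\<close>
  have H: "integrable lebesgue H"
    using Bochner_Integration.integrable_diff[OF F FH] by simp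
  have "cmod ((\<integral>t. F t \<partial>lebesgue) - (\<integral>t. H t \<partial>lebesgue)) = cmod (\<integral>t. F t - H t \<partial>lebesgue)"
    using F H by simp
  also have "\<dots> \<le> (\<integral>t. cmod (F t - H t) \<partial>lebesgue)"
    by (rule integral_norm_bound)
  also have "\<dots> \<le> (\<integral>t. B t \<partial>lebesgue)"
    using FH B FH_le by (intro integral_mono_AE) auto
  also have "\<dots> = kernel_const a b * \<epsilon> * (\<integral>t. P t \<partial>lebesgue) + (\<integral>t. Q t \<partial>lebesgue)"
    unfolding B_def using P Q by simp
  also have "(\<integral>t. Q t \<partial>lebesgue) \<le> L2_norm_on I g / sqrt (2 * k)"
    by (fact Q_le)
  \<comment> \<open>Passing from the height \<open>k\<close> to its lower bound \<open>a\<close>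
    makes the estimate uniform in the lattice point.\<close>
  also have "\<dots> \<le> L2_norm_on I g / sqrt (2 * a)"
    using k a by (intro divide_left_mono real_sqrt_le_mono)
      (auto simp: L2_norm_on_def set_lebesgue_integral_def intro!: integral_nonneg_AE)
  finally show ?thesis
    by (simp add: F_def H_def P_def I_def k_def set_lebesgue_integral_def)
qed

section \<open>Uniformity over compact sets and conclusion\<close>

lemma compact_upper_half_plane_Im_bounds:
  assumes "compact K" "K \<subseteq> upper_half_plane"
  obtains a b where "0 < a" "0 \<le> b" "\<And>z. z \<in> K \<Longrightarrow> a \<le> Im z \<and> Im z \<le> b"
proof (cases "K = {}")
  case False
  have cont: "continuous_on K Im"
    by (intro continuous_intros)
  obtain z w where "z \<in> K" "\<And>u. u \<in> K \<Longrightarrow> Im z \<le> Im u" "w \<in> K" "\<And>u. u \<in> K \<Longrightarrow> Im u \<le> Im w"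
    using continuous_attains_inf[OF assms(1) False cont]
      continuous_attains_sup[OF assms(1) False cont] by blast
  with assms(2) show ?thesis
    by (intro that[of "Im z" "Im w"]) (auto simp: upper_half_plane_def intro: less_imp_le)
\<comment> \<open>For empty \<open>K\<close> the bounds hold vacuously, so any admissible values
  do.\<close>
qed (auto intro: that[of 1 1])

theorem theorem5p1:
  fixes K :: "complex set"
  assumes "compact K" and "K \<subseteq> upper_half_plane"
  shows "\<exists>C::real. \<forall>(f :: complex \<Rightarrow> complex) (g :: real \<Rightarrow> complex) (h :: real \<Rightarrow> complex \<Rightarrow> complex).
    f \<in> hardy_H2 \<longrightarrow>
    g \<in> L2_real \<longrightarrow>
    ess_supp g \<subseteq> {0..} \<longrightarrow>
    (\<forall>x y. y > 0 \<longrightarrow>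
       f (Complex x y) = of_real (1 / sqrt (2 * pi)) *
         (LINT t:{0..}|lebesgue. g t * of_real (exp (- y * t)) * exp (\<i> * of_real (x * t)))) \<longrightarrow>
    (\<forall>\<epsilon> (m::int) (n::nat). 0 < \<epsilon> \<and> \<epsilon> \<le> 1 \<longrightarrow>
       h \<epsilon> (of_real \<epsilon> * of_int m + \<i> * of_real \<epsilon> * of_nat n) = of_real (1 / sqrt (2 * pi)) *
         (LINT t:{0..pi / \<epsilon>}|lebesgue. g t * exp (\<i> * of_real (of_int m * \<epsilon> * t)) *
            of_real ((cos (\<epsilon> * t) / (1 + sin (\<epsilon> * t))) ^ n))) \<longrightarrow>
    (\<exists>M::real. \<forall>\<epsilon>. 0 < \<epsilon> \<and> \<epsilon> \<le> 1 \<longrightarrow>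
       sup_abs_on (K \<inter> scaled_half_lattice \<epsilon>) (\<lambda>z. f z - h \<epsilon> z)
         \<le> C * L2_norm_on {pi / (2 * \<epsilon>)<..<pi / \<epsilon>} g + M * \<epsilon> powr (1 / 4))"
proof -
  obtain a b where a: "0 < a" and b: "0 \<le> b" and ab: "\<And>z. z \<in> K \<Longrightarrow> a \<le> Im z \<and> Im z \<le> b"
    using compact_upper_half_plane_Im_bounds[OF assms] by metis
  define c where "c = 1 / sqrt (2 * pi)"
  have c: "c > 0"
    by (simp add: c_def)
  show ?thesis
  \<comment> \<open>The witness is the normalising factor times the bound for the reflected
    exponential at the lowest height \<open>a\<close>; it is fixed before \<open>f\<close>,
    \<open>g\<close> and \<open>h\<close>.\<close>
  proof (rule exI[of _ "c / sqrt (2 * a)"], intro allI impI, goal_cases)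
    case (1 f g h)
    note g = 1(2) and f = 1(4) and h = 1(5)
    define N where "N = (\<integral>t. cmod (g t) * (indicator {0..} t * exp (- (a / 2) * t)) \<partial>lebesgue)"
    \<comment> \<open>Depends on \<open>g\<close> through \<open>N\<close> and on \<open>K\<close>
      through \<open>a\<close> and \<open>b\<close>, but not on \<epsilon>.\<close>
    define M where "M = c * kernel_const a b * N"
    have "N \<ge> 0"
      unfolding N_def by (intro integral_nonneg_AE) auto
    moreover have "kernel_const a b \<ge> 0"
      using a b by (simp add: kernel_const_def)
    ultimately have M: "M \<ge> 0"
      using c by (simp add: M_def)
    show ?case
    proof (rule exI[of _ M], intro allI impI)
      fix \<epsilon> :: real
      assume \<epsilon>: "0 < \<epsilon> \<and> \<epsilon> \<le> 1"
      define L where "L = L2_norm_on {pi / (2 * \<epsilon>)<..<pi / \<epsilon>} g"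
      define R where "R = c / sqrt (2 * a) * L + M * \<epsilon> powr (1 / 4)"
      have "L \<ge> 0"
        by (auto simp: L_def L2_norm_on_def set_lebesgue_integral_def intro!: integral_nonneg_AE)
      \<comment> \<open>Covers an empty intersection, where \<open>sup_abs_on\<close> takes the
        value 0.\<close>
      then have "R \<ge> 0"
        using c a M by (simp add: R_def)
      have "cmod (f z - h \<epsilon> z) \<le> R" if z: "z \<in> K" "z \<in> scaled_half_lattice \<epsilon>" for z
      proof -
        from z(2) obtain m :: int and n :: nat
          where "z = of_real \<epsilon> * (of_int m + \<i> * of_nat n)"
          by (auto simp: scaled_half_lattice_def half_lattice_def)
        \<comment> \<open>The two forms of \<open>z\<close> match the formulas assumed for
          \<open>h\<close> and for \<open>f\<close> respectively.\<close>
        then have z1: "z = of_real \<epsilon> * of_int m + \<i> * of_real \<epsilon> * of_nat n"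
          and z2: "z = Complex (\<epsilon> * m) (\<epsilon> * n)"
          by (auto simp: algebra_simps complex_eq_iff)
        have n: "a \<le> \<epsilon> * n" "\<epsilon> * n \<le> b"
          using ab[OF z(1)] by (auto simp: z2)
        have "\<epsilon> * n > 0"
          using a n by linarith
        then have fz: "f z = of_real c * (LINT t:{0..}|lebesgue.
            g t * of_real (exp (- (\<epsilon> * n) * t)) * exp (\<i> * of_real (\<epsilon> * m * t)))"
          unfolding z2 c_def by (rule f[rule_format])
        have hz: "h \<epsilon> z = of_real c * (LINT t:{0..pi / \<epsilon>}|lebesgue.
            g t * exp (\<i> * of_real (of_int m * \<epsilon> * t)) * of_real (cayley (\<epsilon> * t) ^ n))"
          unfolding z1 c_def cayley_def by (rule h[rule_format, OF \<epsilon>])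
        have "cmod (f z - h \<epsilon> z) \<le> c * (kernel_const a b * \<epsilon> * N + L / sqrt (2 * a))"
          unfolding fz hz N_def L_def right_diff_distrib[symmetric] norm_mult norm_of_real
            abs_of_pos[OF c]
          using c \<epsilon> by (intro mult_left_mono integral_diff_le[OF g _ a n]) auto
        also have "\<dots> = c / sqrt (2 * a) * L + M * \<epsilon>"
          by (simp add: M_def algebra_simps)
        \<comment> \<open>The error obtained is linear in \<epsilon>; since \<epsilon> is at most 1,
          it is weakened to the stated power.\<close>
        also have "\<epsilon> \<le> \<epsilon> powr (1 / 4)"
          using \<epsilon> powr_mono'[of "1 / 4" 1 \<epsilon>] by simp
        then have "c / sqrt (2 * a) * L + M * \<epsilon> \<le> R"
          using M by (simp add: R_def mult_left_mono)
        finally show ?thesis .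
      qed
      then have "sup_abs_on (K \<inter> scaled_half_lattice \<epsilon>) (\<lambda>z. f z - h \<epsilon> z) \<le> R"
        using \<open>R \<ge> 0\<close> by (auto simp: sup_abs_on_def intro!: cSUP_least)
      then show "sup_abs_on (K \<inter> scaled_half_lattice \<epsilon>) (\<lambda>z. f z - h \<epsilon> z)
          \<le> c / sqrt (2 * a) * L2_norm_on {pi / (2 * \<epsilon>)<..<pi / \<epsilon>} g + M * \<epsilon> powr (1 / 4)"
        by (simp add: R_def L_def)
    qed
  qed
qed

end
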